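(* Let $(G,\cdot)$ be a finite non-abelian solvable group. Then the identities of the additively idempotent semiring $(\mathcal{P}(G),\cup,\cdot)$ (considered as an algebra of type $(2,2)$) admit no finite basis.
   Context: An additively idempotent semiring is an algebra $(S,+,\cdot)$ of type $(2,2)$ such that $+$ and $\cdot$ are associative, $+$ is commutative and idempotent ($x+x=x$), and $x(y+z)=xy+xz$, $(y+z)x=yx+zx$ hold. For a group $(G,\cdot)$, $\mathcal{P}(G)$ denotes the set of all subsets of $G$ (including the empty set), $\cup$ is set-theoretical union, playing the role of addition, and the multiplication is element-wise: $A\cdot B:=\{ab\mid a\in A,\ b\in B\}$ for $A,B\subseteq G$. Then $(\mathcal{P}(G),\cup,\cdot)$ is an additively idempotent semiring, called the power group of $(G,\cdot)$. A basis for the identities of an algebra $\mathcal{A}$ is a set $\Sigma$ of identities holding in $\mathcal{A}$ (in the signature of $\mathcal{A}$) such that every algebra of the same type satisfying $\Sigma$ satisfies all identities of $\mathcal{A}$. The identities of $\mathcal{A}$ admit a finite basis if there is a finite such $\Sigma$. *)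

theory Defs
  imports "HOL-Algebra.Solvable_Groups" "HOL-Library.Countable_Set"
begin

record 'a alg22 = "'a partial_object" +
  aplus :: "'a \<Rightarrow> 'a \<Rightarrow> 'a"
  atimes :: "'a \<Rightarrow> 'a \<Rightarrow> 'a"

definition algebra22 :: "('a, 'm) alg22_scheme \<Rightarrow> bool" where
  "algebra22 A \<longleftrightarrow> carrier A \<noteq> {} \<and>
     (\<forall>x\<in>carrier A. \<forall>y\<in>carrier A. aplus A x y \<in> carrier A \<and> atimes A x y \<in> carrier A)"

datatype tm = Var nat | Plus tm tm | Times tm tm

type_synonym ident = "tm \<times> tm"

primrec tm_val :: "('a, 'm) alg22_scheme \<Rightarrow> (nat \<Rightarrow> 'a) \<Rightarrow> tm \<Rightarrow> 'a" where
  "tm_val A v (Var i) = v i"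
| "tm_val A v (Plus s t) = aplus A (tm_val A v s) (tm_val A v t)"
| "tm_val A v (Times s t) = atimes A (tm_val A v s) (tm_val A v t)"

definition sat_ident :: "('a, 'm) alg22_scheme \<Rightarrow> ident \<Rightarrow> bool" where
  "sat_ident A e \<longleftrightarrow>
     (\<forall>v. range v \<subseteq> carrier A \<longrightarrow> tm_val A v (fst e) = tm_val A v (snd e))"

definition identities :: "('a, 'm) alg22_scheme \<Rightarrow> ident set" where
  "identities A = {e. sat_ident A e}"

text \<open>HOL cannot quantify over types inside a formula, so the clause "every algebra of the same
  type satisfying \<open>\<Sigma>\<close>" ranges over the algebras whose carrier is a nonempty subset of
  the type \<^typ>\<open>'b\<close>. For infinite \<^typ>\<open>'b\<close> this is no restriction: lemma
  \<open>ident_basis_all_algebras\<close> below extends the clause to the algebras over every type,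
  by passing to a countable subalgebra.\<close>

definition ident_basis ::
    "'b itself \<Rightarrow> ('a, 'm) alg22_scheme \<Rightarrow> ident set \<Rightarrow> bool" where
  "ident_basis _ A \<Sigma> \<longleftrightarrow> \<Sigma> \<subseteq> identities A \<and>
     (\<forall>B :: 'b alg22. algebra22 B \<and> \<Sigma> \<subseteq> identities B \<longrightarrow> identities A \<subseteq> identities B)"

definition finite_ident_basis :: "'b itself \<Rightarrow> ('a, 'm) alg22_scheme \<Rightarrow> bool" where
  "finite_ident_basis T A \<longleftrightarrow> (\<exists>\<Sigma>. finite \<Sigma> \<and> ident_basis T A \<Sigma>)"

definition power_group :: "('g, 'm) monoid_scheme \<Rightarrow> 'g set alg22" where
  "power_group G = \<lparr> carrier = Pow (carrier G), aplus = (\<union>), atimes = set_mult G \<rparr>"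

lemma algebra22_power_group: "monoid G \<Longrightarrow> algebra22 (power_group G)"
  by (auto simp: algebra22_def power_group_def set_mult_def intro!: monoid.m_closed)

lemma countable_tm: "countable (UNIV :: tm set)"
proof -
  have "\<exists>f :: tm \<Rightarrow> nat list. inj f"
  proof -
    define f where "f = rec_tm (\<lambda>i. [0, i]) (\<lambda>s t a b. 1 # length a # a @ b)
      (\<lambda>s t a b. Suc 1 # length a # a @ b)"
    have f: "f (Var i) = [0, i]" "f (Plus s t) = 1 # length (f s) # f s @ f t"
      "f (Times s t) = Suc 1 # length (f s) # f s @ f t" for i s t
      by (simp_all add: f_def)
    have "f s = f t \<Longrightarrow> s = t" for s t
    proof (induction s arbitrary: t)
      case (Var i) then show ?case by (cases t) (auto simp: f)
    next
      case (Plus a b) then show ?case by (cases t) (auto simp: f)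
    next
      case (Times a b) then show ?case by (cases t) (auto simp: f)
    qed
    then show ?thesis by (auto simp: inj_def)
  qed
  then show ?thesis
    by (meson countableI' countable_image_inj_on countableI_type countable_subset subset_UNIV)
qed

lemma tm_val_closed:
  assumes "algebra22 A" "range v \<subseteq> carrier A"
  shows "tm_val A v t \<in> carrier A"
  using assms by (induction t) (auto simp: algebra22_def)

primrec tm_subst :: "(nat \<Rightarrow> tm) \<Rightarrow> tm \<Rightarrow> tm" where
  "tm_subst \<sigma> (Var i) = \<sigma> i"
| "tm_subst \<sigma> (Plus s t) = Plus (tm_subst \<sigma> s) (tm_subst \<sigma> t)"
| "tm_subst \<sigma> (Times s t) = Times (tm_subst \<sigma> s) (tm_subst \<sigma> t)"

lemma tm_val_subst: "tm_val A v (tm_subst \<sigma> t) = tm_val A (\<lambda>i. tm_val A v (\<sigma> i)) t"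
  by (induction t) auto

lemma ident_basis_all_algebras:
  fixes A :: "('a, 'm) alg22_scheme" and C :: "('c, 'n) alg22_scheme"
  assumes inf: "infinite (UNIV :: 'b set)" and basis: "ident_basis TYPE('b) A \<Sigma>"
    and C: "algebra22 C" "\<Sigma> \<subseteq> identities C"
  shows "identities A \<subseteq> identities C"
proof (clarsimp simp: identities_def sat_ident_def)
  fix s t and v :: "nat \<Rightarrow> 'c"
  assume st: "\<forall>v. range v \<subseteq> carrier A \<longrightarrow> tm_val A v s = tm_val A v t"
    and v: "range v \<subseteq> carrier C"
  let ?D = "range (tm_val C v)"
  have "countable ?D" using countable_tm by blast
  moreover obtain g :: "nat \<Rightarrow> 'b" where g: "inj g"
    using inf infinite_countable_subset by blast
  ultimately obtain f :: "'c \<Rightarrow> 'b" where f: "inj_on f ?D"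
    by (metis comp_inj_on countable_def inj_on_subset subset_UNIV)
  define h where "h = inv_into ?D f"
  have h: "h (f (tm_val C v u)) = tm_val C v u" for u
    unfolding h_def by (rule inv_into_f_f[OF f]) auto
  define B :: "'b alg22" where "B = \<lparr> carrier = f ` ?D,
    aplus = (\<lambda>x y. f (aplus C (h x) (h y))), atimes = (\<lambda>x y. f (atimes C (h x) (h y))) \<rparr>"
  have B: "algebra22 B"
    unfolding algebra22_def
  proof (intro conjI ballI)
    show "carrier B \<noteq> {}" by (simp add: B_def)
    fix x y assume "x \<in> carrier B" "y \<in> carrier B"
    then obtain p q where xy: "x = f (tm_val C v p)" "y = f (tm_val C v q)"
      by (auto simp: B_def)
    have "aplus B x y = f (tm_val C v (Plus p q))" by (simp add: B_def xy h)
    then show "aplus B x y \<in> carrier B" by (auto simp: B_def simp del: tm_val.simps)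
    have "atimes B x y = f (tm_val C v (Times p q))" by (simp add: B_def xy h)
    then show "atimes B x y \<in> carrier B" by (auto simp: B_def simp del: tm_val.simps)
  qed
  have val: "tm_val B (\<lambda>i. f (tm_val C v (\<sigma> i))) u = f (tm_val C v (tm_subst \<sigma> u))" for \<sigma> u
    by (induction u) (simp_all add: B_def h)
  have "\<Sigma> \<subseteq> identities B"
  proof (clarsimp simp: identities_def sat_ident_def)
    fix l r and w :: "nat \<Rightarrow> 'b"
    assume lr: "(l, r) \<in> \<Sigma>" and w: "range w \<subseteq> carrier B"
    have "\<forall>i. \<exists>u. w i = f (tm_val C v u)" using w by (auto simp: B_def)
    then obtain \<sigma> where \<sigma>: "w = (\<lambda>i. f (tm_val C v (\<sigma> i)))" by metis
    have "tm_val C (\<lambda>i. tm_val C v (\<sigma> i)) l = tm_val C (\<lambda>i. tm_val C v (\<sigma> i)) r"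
      using lr C(2) tm_val_closed[OF C(1) v]
      by (fastforce simp: identities_def sat_ident_def)
    then show "tm_val B w l = tm_val B w r" by (simp add: \<sigma> val tm_val_subst)
  qed
  with basis B have "identities A \<subseteq> identities B" by (auto simp: ident_basis_def)
  moreover have "(s, t) \<in> identities A" using st by (simp add: identities_def sat_ident_def)
  ultimately have "(s, t) \<in> identities B" by blast
  moreover have "range (\<lambda>i. f (tm_val C v (Var i))) \<subseteq> carrier B"
    unfolding B_def by (auto simp del: tm_val.simps)
  ultimately have "tm_val B (\<lambda>i. f (tm_val C v (Var i))) s = tm_val B (\<lambda>i. f (tm_val C v (Var i))) t"
    unfolding identities_def sat_ident_def by auto
  moreover have "tm_val C v (tm_subst Var u) = tm_val C v u" for u
    by (simp add: tm_val_subst)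
  ultimately have "f (tm_val C v s) = f (tm_val C v t)" by (simp only: val)
  then show "tm_val C v s = tm_val C v t" using h by metis
qed

corollary ident_basis_carrier_type_irrelevant:
  fixes A :: "('a, 'm) alg22_scheme"
  assumes "infinite (UNIV :: 'b set)" and "ident_basis TYPE('b) A \<Sigma>"
  shows "ident_basis TYPE('c) A \<Sigma>"
  using ident_basis_all_algebras[OF assms] assms(2) by (auto simp: ident_basis_def)

end

theory Submission
  imports Defs "HOL-Library.Ramsey"
begin

text \<open>Suppose all words in the identities of \<open>\<Sigma>\<close> have length at most \<open>n\<close>. Let \<open>u = x\<^sub>0 \<dots> x\<^bsub>N-1\<^esub>\<close>, and
  for a set \<open>e\<close> of cut positions let \<open>u\<^sub>e\<close> be \<open>u\<close> with the order of the factors between consecutive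
  cuts reversed. If the prefix products of an evaluation of \<open>u\<close> in \<open>G\<close> agree on \<open>e\<close>, then these factors
  evaluate to \<open>1\<close>, so \<open>u\<close> and \<open>u\<^sub>e\<close> have the same value. Ramsey's theorem for pairs provides a family
  \<open>E\<close> such that every evaluation has such an \<open>e \<in> E\<close>, although distinct members of \<open>E\<close> differ in more
  than \<open>n + 4\<close> places. Hence the power group satisfies \<open>u \<le> \<Sum>\<^sub>e u\<^sub>e\<close>, whereas no two of the words in
  \<open>C = {u\<^sub>e. e \<in> E}\<close> arise from each other by rearranging \<open>n\<close> factors.

  The syntactic semiring of \<open>C\<close> violates \<open>u \<le> \<Sum>\<^sub>e u\<^sub>e\<close>. It satisfies \<open>\<Sigma>\<close>: if \<open>p v\<^sub>1 \<dots> v\<^sub>l q \<notin> C\<close> with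
  \<open>l \<le> n\<close>, then sending one or two of the factors \<open>v\<^sub>i\<close> to suitable elements of \<open>G\<close> and the others to
  \<open>1\<close> separates \<open>v\<^sub>1 \<dots> v\<^sub>l\<close> from all products \<open>v\<^bsub>i\<^esub> \<dots> v\<^bsub>j\<^esub>\<close> with \<open>p v\<^bsub>i\<^esub> \<dots> v\<^bsub>j\<^esub> q \<in> C\<close>. If these use every
  factor, there is only one of them, and two non-commuting elements detect an inversion; otherwise an
  element \<open>d\<close> with \<open>d\<^sup>2 \<noteq> 1\<close> suffices.\<close>

section \<open>Words obtained by reversing the order of factors\<close>

text \<open>The sets are the edge sets of the complete graphs on \<open>k + 1\<close> vertices, with pairs coded as
  numbers: two of them differ by all edges at a vertex.\<close>

lemma ex_separated_family:
  "\<exists>N E. E \<subseteq> Pow {0<..<N::nat} \<and> (\<forall>e\<in>E. k \<le> card e) \<and>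
     (\<forall>e\<in>E. \<forall>e'\<in>E. e \<noteq> e' \<longrightarrow> k \<le> card (e' - e)) \<and>
     (\<forall>f :: nat \<Rightarrow> nat. f ` {0<..<N} \<subseteq> {..<c} \<longrightarrow> (\<exists>e\<in>E. \<exists>i. \<forall>t\<in>e. f t = i))"
proof -
  obtain M :: nat where M: "partn_lst {..<M} (replicate c (Suc k)) 2"
    using ramsey_full by blast
  \<comment> \<open>Base \<open>M\<close> notation, injective on pairs below \<open>M\<close>: the
    larger entry is the last digit.\<close>
  define code where "code = (\<lambda>P. Min P * M + Max P)"
  define E where "E = (\<lambda>K. code ` [K]\<^bsup>2\<^esup>) ` [{..<M}]\<^bsup>Suc k\<^esup>"
  have code: "code {a, b} = min a b * M + max a b" for a b :: nat
    by (simp add: code_def)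
  have pair: "\<exists>a b. P = {a, b} \<and> a < b \<and> b < M" if P: "P \<in> [{..<M}]\<^bsup>2\<^esup>" for P
  proof -
    obtain x y where xy: "P = {x, y}" "x \<noteq> y" "x < M" "y < M" using P by (auto simp: nsets_2_eq)
    then show ?thesis by (cases x y rule: linorder_cases) (auto simp: insert_commute)
  qed
  have inj: "inj_on code ([{..<M}]\<^bsup>2\<^esup>)"
  proof (rule inj_onI)
    fix P Q assume "P \<in> [{..<M}]\<^bsup>2\<^esup>" "Q \<in> [{..<M}]\<^bsup>2\<^esup>" and eq: "code P = code Q"
    then obtain a b c d where P: "P = {a, b}" "a < b" "b < M" and Q: "Q = {c, d}" "c < d" "d < M"
      using pair by meson
    have cc: "a * M + b = c * M + d" using eq P Q by (simp add: code)
    have "(a * M + b) mod M = b" "(c * M + d) mod M = d"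
      by (simp_all only: mod_mult_self3 mod_less P(3) Q(3))
    then have "b = d" using cc by simp
    then have "a = c" using cc P(3) by (cases "M = 0") auto
    then show "P = Q" by (simp only: P Q \<open>b = d\<close>)
  qed
  \<comment> \<open>The \<open>k\<close> edges of \<open>K\<close> at a vertex \<open>z\<close>
    outside \<open>L\<close> are not edges of \<open>L\<close>.\<close>
  have star: "k \<le> card (code ` ([K]\<^bsup>2\<^esup>) - code ` ([L]\<^bsup>2\<^esup>))"
    if K: "K \<in> [{..<M}]\<^bsup>Suc k\<^esup>" and L: "L \<subseteq> {..<M}" and z: "z \<in> K" "z \<notin> L" for K L z
  proof -
    let ?S = "(\<lambda>y. {z, y}) ` (K - {z})"
    have S: "?S \<subseteq> [K]\<^bsup>2\<^esup>" using z by (auto simp: nsets_2_eq)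
    have KM: "[K]\<^bsup>2\<^esup> \<subseteq> [{..<M}]\<^bsup>2\<^esup>" using K by (intro nsets_mono) (simp add: nsets_def)
    have "code ` ?S \<inter> code ` ([L]\<^bsup>2\<^esup>) = {}"
    proof (rule ccontr)
      assume "\<not> ?thesis"
      then obtain P Q where PQ: "P \<in> ?S" "Q \<in> [L]\<^bsup>2\<^esup>" "code P = code Q" by blast
      have "P \<in> [{..<M}]\<^bsup>2\<^esup>" "Q \<in> [{..<M}]\<^bsup>2\<^esup>"
        using PQ(1,2) S KM nsets_mono[OF L, of 2] by blast+
      then have "P = Q" using inj PQ(3) by (auto dest: inj_onD)
      then have "z \<in> L" using PQ(1,2) by (auto simp: nsets_def)
      then show False using z by simp
    qed
    then have sub: "code ` ?S \<subseteq> code ` ([K]\<^bsup>2\<^esup>) - code ` ([L]\<^bsup>2\<^esup>)" using S by blast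
    have "inj_on (\<lambda>y. {z, y}) (K - {z})" by (auto simp: inj_on_def doubleton_eq_iff)
    moreover have "inj_on code ?S"
      by (rule inj_on_subset[OF inj]) (rule order.trans[OF S KM])
    ultimately have "card (code ` ?S) = card (K - {z})" by (simp add: card_image)
    also have "\<dots> = k" using K z by (simp add: nsets_def)
    finally have "card (code ` ?S) = k" .
    moreover have "finite (code ` ([K]\<^bsup>2\<^esup>))"
      using K by (intro finite_imageI finite_imp_finite_nsets) (simp add: nsets_def)
    ultimately show ?thesis using card_mono[OF _ sub] by auto
  qed
  have 1: "E \<subseteq> Pow {0<..<M * M}"
  proof (clarsimp simp: E_def)
    fix K P assume "K \<in> [{..<M}]\<^bsup>Suc k\<^esup>" "P \<in> [K]\<^bsup>2\<^esup>"
    then have "P \<in> [{..<M}]\<^bsup>2\<^esup>" by (auto simp: nsets_def)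
    then obtain a b where P: "P = {a, b}" "a < b" "b < M"
      using pair by blast
    have "a * M + b < Suc a * M" using P by simp
    also have "\<dots> \<le> M * M" using P by (intro mult_right_mono) auto
    finally show "0 < code P \<and> code P < M * M" using P by (simp add: code)
  qed
  have 2: "k \<le> card e" if e: "e \<in> E" for e
  proof -
    obtain K where K: "K \<in> [{..<M}]\<^bsup>Suc k\<^esup>" "e = code ` [K]\<^bsup>2\<^esup>"
      using e unfolding E_def by blast
    then have "card K = Suc k" by (simp add: nsets_def)
    then obtain z where "z \<in> K" by (cases "K = {}") auto
    from star[OF K(1) _ this, of "{}"] show ?thesis by (simp add: K nsets_empty_iff)
  qed
  have 3: "k \<le> card (e' - e)" if e: "e \<in> E" "e' \<in> E" "e \<noteq> e'" for e e'
  proof -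
    obtain K L where K: "K \<in> [{..<M}]\<^bsup>Suc k\<^esup>" "e' = code ` [K]\<^bsup>2\<^esup>"
      and L: "L \<in> [{..<M}]\<^bsup>Suc k\<^esup>" "e = code ` [L]\<^bsup>2\<^esup>"
      using e(1,2) unfolding E_def by blast
    have "K \<noteq> L" using K L e by auto
    then have "\<not> K \<subseteq> L" using K(1) L(1) card_subset_eq[of L K] unfolding nsets_def by auto
    then obtain z where "z \<in> K" "z \<notin> L" by blast
    moreover have "L \<subseteq> {..<M}" using L(1) by (simp add: nsets_def)
    ultimately show ?thesis using star[OF K(1)] L(2) K(2) by simp
  qed
  \<comment> \<open>Through \<open>code\<close>, \<open>f\<close> colours the edges; the edge set of
    a homogeneous vertex set is a member of \<open>E\<close> on which \<open>f\<close> is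
    constant.\<close>
  have 4: "\<exists>e\<in>E. \<exists>i. \<forall>t\<in>e. f t = i" if f: "f ` {0<..<M * M} \<subseteq> {..<c}" for f :: "nat \<Rightarrow> nat"
  proof -
    have "f \<circ> code \<in> [{..<M}]\<^bsup>2\<^esup> \<rightarrow> {..<c}"
    proof
      fix P assume "P \<in> [{..<M}]\<^bsup>2\<^esup>"
      then obtain a b where P: "P = {a, b}" "a < b" "b < M"
        using pair by blast
      have "a * M + b < Suc a * M" using P by simp
      also have "\<dots> \<le> M * M" using P by (intro mult_right_mono) auto
      finally show "(f \<circ> code) P \<in> {..<c}" using P f by (auto simp: code image_subset_iff)
    qed
    then obtain i H where "i < c" "H \<in> [{..<M}]\<^bsup>Suc k\<^esup>" "(f \<circ> code) ` [H]\<^bsup>2\<^esup> \<subseteq> {i}"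
      by (elim partn_lstE[OF M]) auto
    then have "code ` [H]\<^bsup>2\<^esup> \<in> E" "\<forall>t\<in>code ` [H]\<^bsup>2\<^esup>. f t = i" unfolding E_def by auto
    then show ?thesis by blast
  qed
  show ?thesis by (intro exI[of _ "M * M"] exI[of _ E] conjI ballI allI impI 1 2 3 4)
qed

section \<open>Reversing the order of the blocks between cuts\<close>

fun rev_blocks :: "nat list \<Rightarrow> nat list" where
  "rev_blocks (s # t # ts) = rev_blocks (t # ts) @ [s..<t]"
| "rev_blocks _ = []"

text \<open>Only the order of the blocks changes; each block stays increasing. For empty
  \<open>e\<close> the values of \<open>hd\<close> and \<open>last\<close> are unspecified, hence
  nonempty \<open>e\<close> throughout.\<close>

definition cut_word :: "nat \<Rightarrow> nat set \<Rightarrow> nat list" where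
  "cut_word N e = (let ts = sorted_list_of_set e in [0..<hd ts] @ rev_blocks ts @ [last ts..<N])"

lemma le_last_if_strict_sorted: "sorted_wrt (<) ts \<Longrightarrow> (t::nat) \<in> set ts \<Longrightarrow> t \<le> last ts"
  by (induction ts) (auto intro: less_imp_le)

lemma set_rev_blocks: "sorted_wrt (<) (t # ts) \<Longrightarrow> set (rev_blocks (t # ts)) = {t..<last (t # ts)}"
proof (induction ts arbitrary: t)
  case (Cons u us)
  then show ?case using le_last_if_strict_sorted[of "u # us" u] by auto
qed simp

lemma distinct_rev_blocks: "sorted_wrt (<) ts \<Longrightarrow> distinct (rev_blocks ts)"
proof (induction ts rule: rev_blocks.induct)
  case (1 s t ts)
  then show ?case using set_rev_blocks[of t ts] by auto
qed auto

text \<open>An inner cut \<open>t\<close> starts a block, and the preceding block, which ends in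
  \<open>t - 1\<close>, is moved behind it. No block starts at the last cut.\<close>

lemma rev_blocks_inverted:
  assumes "sorted_wrt (<) (s # ts)" "t \<in> set ts" "t \<noteq> last (s # ts)"
  shows "\<exists>xs ys. rev_blocks (s # ts) = xs @ t # ys \<and> t - 1 \<in> set ys"
  using assms
proof (induction ts arbitrary: s)
  case (Cons u us)
  show ?case
  proof (cases "t = u")
    case True
    then have "us \<noteq> []" "t \<le> last (u # us)" using Cons.prems le_last_if_strict_sorted[of "u # us" u] by auto
    then have "t \<in> set (rev_blocks (u # us))"
      using Cons.prems True set_rev_blocks[of u us] by auto
    then obtain xs ys where "rev_blocks (u # us) = xs @ t # ys" by (meson split_list)
    moreover have "t - 1 \<in> set [s..<u]" using Cons.prems True by auto
    ultimately show ?thesis by (intro exI[of _ xs] exI[of _ "ys @ [s..<u]"]) auto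
  next
    case False
    then obtain xs ys where "rev_blocks (u # us) = xs @ t # ys" "t - 1 \<in> set ys"
      using Cons.IH[of u] Cons.prems by auto
    then show ?thesis by (intro exI[of _ xs] exI[of _ "ys @ [s..<u]"]) auto
  qed
qed simp

lemma upt_consecutive:
  assumes "a < t" "t < b"
  shows "\<exists>xs ys. [a..<b] = xs @ [t - 1, t] @ ys"
proof -
  have "[a..<b] = [a..<t - 1] @ [t - 1..<b]" using assms upt_add_eq_append[of a "t - 1" "b - (t - 1)"] by simp
  also have "[t - 1..<b] = (t - 1) # t # [Suc t..<b]" using assms by (simp add: upt_conv_Cons)
  finally show ?thesis by (intro exI) simp
qed

text \<open>Such a \<open>t\<close> lies in the same block as \<open>t - 1\<close>, and blocks are
  moved as a whole.\<close>

lemma rev_blocks_consecutive: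
  assumes "sorted_wrt (<) (s # ts)" "t \<notin> set ts" "s < t" "t < last (s # ts)"
  shows "\<exists>xs ys. rev_blocks (s # ts) = xs @ [t - 1, t] @ ys"
  using assms
proof (induction ts arbitrary: s)
  case (Cons u us)
  show ?case
  proof (cases "t < u")
    case True
    then obtain xs ys where "[s..<u] = xs @ [t - 1, t] @ ys" using upt_consecutive Cons.prems by blast
    then show ?thesis by (intro exI[of _ "rev_blocks (u # us) @ xs"] exI[of _ ys]) auto
  next
    case False
    then obtain xs ys where "rev_blocks (u # us) = xs @ [t - 1, t] @ ys"
      using Cons.IH[of u] Cons.prems by auto
    then show ?thesis by (intro exI[of _ xs] exI[of _ "ys @ [s..<u]"]) auto
  qed
qed simp

lemma cut_word_cases:
  assumes "finite e" "e \<noteq> {}"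
  obtains s ts where "sorted_wrt (<) (s # ts)" "set (s # ts) = e" "s = Min e" "last (s # ts) = Max e"
    "cut_word N e = [0..<s] @ rev_blocks (s # ts) @ [Max e..<N]"
proof -
  obtain s ts where st: "sorted_list_of_set e = s # ts"
    using assms by (cases "sorted_list_of_set e") auto
  have sw: "sorted_wrt (<) (s # ts)" using strict_sorted_list_of_set[of e] st by simp
  have se: "set (s # ts) = e" using assms st by (metis set_sorted_list_of_set)
  have "s = Min e" using sw se assms by (intro Min_eqI[symmetric]) auto
  moreover have "y \<le> last (s # ts)" if "y \<in> set (s # ts)" for y
    using that sw le_last_if_strict_sorted by blast
  then have "last (s # ts) = Max e"
    using se assms last_in_set[of "s # ts"] by (intro Max_eqI[symmetric]) auto
  ultimately show thesis using that[OF sw se] st by (simp add: cut_word_def Let_def)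
qed

lemma set_distinct_cut_word:
  assumes "finite e" "e \<noteq> {}" "e \<subseteq> {..N}"
  shows "set (cut_word N e) = {..<N}" "distinct (cut_word N e)"
proof -
  obtain s ts where *: "sorted_wrt (<) (s # ts)" "s = Min e" "last (s # ts) = Max e"
    "cut_word N e = [0..<s] @ rev_blocks (s # ts) @ [Max e..<N]"
    using cut_word_cases[OF assms(1,2)] by metis
  have "Min e \<le> Max e" "Max e \<le> N" using assms by auto
  then show "set (cut_word N e) = {..<N}" "distinct (cut_word N e)"
    using * set_rev_blocks[OF *(1)] distinct_rev_blocks[OF *(1)] by auto
qed

lemma cut_word_inverted:
  assumes "finite e" "t \<in> e" "t \<noteq> Min e" "t \<noteq> Max e"
  shows "\<exists>xs ys. cut_word N e = xs @ t # ys \<and> t - 1 \<in> set ys"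
proof -
  have "e \<noteq> {}" using assms by auto
  then obtain s ts where *: "sorted_wrt (<) (s # ts)" "set (s # ts) = e" "s = Min e"
    "last (s # ts) = Max e" "cut_word N e = [0..<s] @ rev_blocks (s # ts) @ [Max e..<N]"
    using cut_word_cases[OF assms(1)] by metis
  have "t \<in> set ts" using * assms by auto
  then obtain xs ys where "rev_blocks (s # ts) = xs @ t # ys" "t - 1 \<in> set ys"
    using rev_blocks_inverted[of s ts t] * assms by auto
  then show ?thesis using *(5)
    by (intro exI[of _ "[0..<s] @ xs"] exI[of _ "ys @ [Max e..<N]"]) auto
qed

lemma cut_word_consecutive:
  assumes "finite e" "e \<noteq> {}" "t \<notin> e" "0 < t" "t < N"
  shows "\<exists>xs ys. cut_word N e = xs @ [t - 1, t] @ ys"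
proof -
  obtain s ts where *: "sorted_wrt (<) (s # ts)" "set (s # ts) = e" "s = Min e"
    "last (s # ts) = Max e" "cut_word N e = [0..<s] @ rev_blocks (s # ts) @ [Max e..<N]"
    using cut_word_cases[OF assms(1,2)] by metis
  have ne: "t \<noteq> s" "t \<noteq> Max e"
    using *(2) Max_in[OF assms(1,2)] assms(3) by (metis list.set_intros(1), metis)
  consider "t < s" | "s < t" "t < Max e" | "Max e < t" using ne by linarith
  then show ?thesis
  proof cases
    case 1
    then obtain xs ys where "[0..<s] = xs @ [t - 1, t] @ ys" using upt_consecutive assms by blast
    then show ?thesis using *(5)
      by (intro exI[of _ xs] exI[of _ "ys @ rev_blocks (s # ts) @ [Max e..<N]"]) auto
  next
    case 2
    then obtain xs ys where "rev_blocks (s # ts) = xs @ [t - 1, t] @ ys"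
      using rev_blocks_consecutive[of s ts t] * assms by auto
    then show ?thesis using *(5)
      by (intro exI[of _ "[0..<s] @ xs"] exI[of _ "ys @ [Max e..<N]"]) auto
  next
    case 3
    then obtain xs ys where "[Max e..<N] = xs @ [t - 1, t] @ ys" using upt_consecutive assms by blast
    then show ?thesis using *(5)
      by (intro exI[of _ "[0..<s] @ rev_blocks (s # ts) @ xs"] exI[of _ ys]) auto
  qed
qed

section \<open>Languages that admit no rearrangement of few factors\<close>

text \<open>Comparing sets of factors suffices here: in a word without repeated letters no nonempty
  factor occurs twice.\<close>

definition scattered :: "nat \<Rightarrow> 'a list set \<Rightarrow> bool" where
  "scattered n C \<longleftrightarrow> (\<forall>us vs p q. length us \<le> n \<and> set us = set vs \<and>
     p @ concat us @ q \<in> C \<and> p @ concat vs @ q \<in> C \<longrightarrow> concat us = concat vs)"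

text \<open>Each adjacent pair broken by a factorization uses up the head of a factor, so few
  factors break few pairs.\<close>

lemma consecutive_in_concat:
  assumes "concat L = xs @ [a, b] @ ys"
  shows "b \<in> hd ` set L \<or> (\<exists>v\<in>set L. \<exists>xs' ys'. v = xs' @ [a, b] @ ys')"
  using assms
proof (induction L arbitrary: xs)
  case (Cons v L)
  then have eq: "v @ concat L = xs @ [a, b] @ ys" by simp
  then consider us where "xs = v @ us" "concat L = us @ [a, b] @ ys"
    | "v = xs" "concat L = [a, b] @ ys" | "v = xs @ [a]" "concat L = b # ys"
    | us where "v = xs @ [a, b] @ us"
    by (auto simp: append_eq_append_conv2 append_eq_Cons_conv Cons_eq_append_conv)
  then show ?case
  proof cases
    case 1
    then show ?thesis using Cons.IH by fastforce
  next
    case 2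
    then show ?thesis using Cons.IH[of "[]"] by fastforce
  next
    case 3
    have "concat K = b # zs \<Longrightarrow> b \<in> hd ` set K" for K :: "'a list list" and zs
      by (induction K) (auto simp: append_eq_Cons_conv)
    then show ?thesis using 3 by auto
  next
    case 4
    then show ?thesis by auto
  qed
qed simp

lemma not_inverted_if_consecutive:
  assumes "distinct L" "L = xs @ a # b # ys" "L = us @ b # zs"
  shows "a \<notin> set zs"
proof
  assume "a \<in> set zs"
  then obtain z1 z2 where "zs = z1 @ a # z2" by (meson split_list)
  then have "xs @ a # (b # ys) = (us @ b # z1) @ a # z2" using assms by simp
  moreover have "a \<notin> set xs" "a \<notin> set (b # ys)" using assms(1,2) by auto
  ultimately have "xs = us @ b # z1" by (subst (asm) append_Cons_eq_iff) auto
  then show False using assms(1,2) by auto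
qed

text \<open>Let \<open>t\<close> be in \<open>e' - e\<close>, but not an extreme cut of
  \<open>e'\<close>. Then \<open>t - 1\<close> and \<open>t\<close> are adjacent in the word of
  \<open>e\<close> and inverted in that of \<open>e'\<close>. A common factor cannot contain this
  pair, so \<open>t\<close> is the head of one of the at most \<open>n + 2\<close> factors
  \<open>p\<close>, \<open>q\<close> and \<open>us\<close>. With the two extreme cuts this bounds
  \<open>e' - e\<close> by \<open>n + 4\<close> elements.\<close>

lemma scattered_cut_words:
  assumes E: "E \<subseteq> Pow {0<..<N}" and ne: "{} \<notin> E"
    and far: "\<And>e e'. e \<in> E \<Longrightarrow> e' \<in> E \<Longrightarrow> e \<noteq> e' \<Longrightarrow> n + 5 \<le> card (e' - e)"
  shows "scattered n (cut_word N ` E)"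
  unfolding scattered_def
proof (intro allI impI, elim conjE imageE)
  fix us vs :: "nat list list" and p q e e'
  assume n: "length us \<le> n" and uv: "set us = set vs" and e: "e \<in> E" "e' \<in> E"
    and w: "p @ concat us @ q = cut_word N e" "p @ concat vs @ q = cut_word N e'"
  have fin: "finite e" "finite e'" "e \<noteq> {}" "e' \<noteq> {}" "e' \<subseteq> {0<..<N}" "e' \<subseteq> {..N}"
    using E e ne finite_subset[of _ "{0<..<N}"] by (blast, blast, blast, blast, blast, force)
  have "e = e'"
  proof (rule ccontr)
    assume "e \<noteq> e'"
    then have big: "n + 5 \<le> card (e' - e)" using far e by auto
    let ?H = "hd ` set (p # q # us)"
    have "e' - e \<subseteq> ?H \<union> {Min e', Max e'}"
    proof
      fix t assume t: "t \<in> e' - e"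
      show "t \<in> ?H \<union> {Min e', Max e'}"
      proof (rule ccontr)
        assume nt: "t \<notin> ?H \<union> {Min e', Max e'}"
        have "0 < t" "t < N" using t fin by auto
        then obtain xs ys where "cut_word N e = xs @ [t - 1, t] @ ys"
          using cut_word_consecutive[of e t N] fin t by auto
        then have "concat (p # us @ [q]) = xs @ [t - 1, t] @ ys" using w by simp
        from consecutive_in_concat[OF this] nt
        obtain v xs' ys' where v: "v \<in> set (p # us @ [q])" "v = xs' @ [t - 1, t] @ ys'" by auto
        then have "v \<in> set (p # vs @ [q])" using uv by auto
        then obtain as bs where "p # vs @ [q] = as @ v # bs" by (meson split_list)
        then have "concat (p # vs @ [q]) = concat (as @ v # bs)" by simp
        then have 1: "cut_word N e' = (concat as @ xs') @ (t - 1) # t # ys' @ concat bs"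
          using w v by simp
        obtain us' zs where 2: "cut_word N e' = us' @ t # zs" "t - 1 \<in> set zs"
          using cut_word_inverted[of e' t N] fin t nt by auto
        have "distinct (cut_word N e')" using set_distinct_cut_word[of e' N] fin by auto
        then show False using not_inverted_if_consecutive[OF _ 1 2(1)] 2(2) by blast
      qed
    qed
    then have "card (e' - e) \<le> card (?H \<union> {Min e', Max e'})" by (intro card_mono) auto
    also have "\<dots> \<le> card ?H + card {Min e', Max e'}" by (rule card_Un_le)
    also have "card ?H \<le> length (p # q # us)"
      by (rule order.trans[OF card_image_le card_length]) simp
    also have "card {Min e', Max e'} \<le> 2" using card_length[of "[Min e', Max e']"] by simp
    finally show False using big n by simp
  qed
  then have "p @ concat us @ q = p @ concat vs @ q" using w by simp
  then show "concat us = concat vs" by (simp only: append_same_eq same_append_eq)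
qed

section \<open>Separating words by elements of the group\<close>

definition mprod :: "('a, 'm) monoid_scheme \<Rightarrow> 'a list \<Rightarrow> 'a" where
  "mprod G xs = foldr (mult G) xs (one G)"

lemma mprod_simps [simp]: "mprod G [] = \<one>\<^bsub>G\<^esub>" "mprod G (x # xs) = x \<otimes>\<^bsub>G\<^esub> mprod G xs"
  by (simp_all add: mprod_def)

context monoid
begin

lemma mprod_closed [simp]: "set xs \<subseteq> carrier G \<Longrightarrow> mprod G xs \<in> carrier G"
  by (induction xs) auto

lemma mprod_append:
  "set xs \<subseteq> carrier G \<Longrightarrow> set ys \<subseteq> carrier G \<Longrightarrow> mprod G (xs @ ys) = mprod G xs \<otimes> mprod G ys"
  by (induction xs) (auto simp: m_assoc)

lemma mprod_filter:
  "range \<phi> \<subseteq> carrier G \<Longrightarrow> (\<And>i. \<not> P i \<Longrightarrow> \<phi> i = \<one>) \<Longrightarrow>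
     mprod G (map \<phi> xs) = mprod G (map \<phi> (filter P xs))"
proof (induction xs)
  case (Cons x xs)
  have "mprod G (map \<phi> (filter P xs)) \<in> carrier G" using Cons.prems by (intro mprod_closed) auto
  then show ?case using Cons by auto
qed simp

end

section \<open>Index lists that select factors of a word\<close>

lemma distinct_pair_list:
  assumes "distinct L" "set L = {i, j}" "i \<noteq> j"
  shows "L = [i, j] \<or> L = [j, i]"
proof -
  have "length L = 2" using assms distinct_card[of L] by simp
  then obtain a b where "L = [a, b]" by (auto simp: length_Suc_conv numeral_2_eq_2)
  then show ?thesis using assms by (auto simp: doubleton_eq_iff)
qed

lemma not_sorted_inversion:
  "\<not> sorted L \<Longrightarrow> \<exists>i j xs ys zs. i < j \<and> L = xs @ j # ys @ i # zs"
proof (induction L)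
  case (Cons x L)
  show ?case
  proof (cases "sorted L")
    case True
    then obtain y where "y \<in> set L" "y < x" using Cons.prems by auto
    then show ?thesis by (metis append_Nil split_list)
  next
    case False
    then show ?thesis using Cons.IH by (metis append_Cons)
  qed
qed simp

text \<open>An empty factor could be repeated without repeating a letter, hence the second
  assumption.\<close>

lemma distinct_concat_map:
  assumes "distinct (concat (map f I))" "\<And>i. i \<in> set I \<Longrightarrow> f i \<noteq> []"
  shows "distinct I" "\<And>i j. i \<in> set I \<Longrightarrow> j \<in> set I \<Longrightarrow> i \<noteq> j \<Longrightarrow> set (f i) \<inter> set (f j) = {}"
proof -
  have "distinct I \<and> (\<forall>i\<in>set I. \<forall>j\<in>set I. i \<noteq> j \<longrightarrow> set (f i) \<inter> set (f j) = {})"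
    using assms
  proof (induction I)
    case (Cons i I)
    have "i \<notin> set I"
    proof
      assume i: "i \<in> set I"
      then have "set (f i) \<subseteq> set (concat (map f I))" by auto
      moreover have "set (f i) \<inter> set (concat (map f I)) = {}"
        using Cons.prems(1) by (simp only: list.map concat.simps distinct_append)
      moreover have "f i \<noteq> []" using Cons.prems(2)[of i] by simp
      ultimately have "set (f i) = {}" by (simp only: inf.absorb1)
      then show False using \<open>f i \<noteq> []\<close> by simp
    qed
    moreover have "set (f i) \<inter> set (f j) = {}" if "j \<in> set I" for j
      using Cons.prems(1) that by auto
    moreover have "distinct I \<and> (\<forall>i\<in>set I. \<forall>j\<in>set I. i \<noteq> j \<longrightarrow> set (f i) \<inter> set (f j) = {})"
      using Cons.prems by (intro Cons.IH) simp_all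
    ultimately show ?case by (simp add: Int_commute)
  qed simp
  then show "distinct I" "\<And>i j. i \<in> set I \<Longrightarrow> j \<in> set I \<Longrightarrow> i \<noteq> j \<Longrightarrow> set (f i) \<inter> set (f j) = {}"
    by blast+
qed

text \<open>Distinct indices have disjoint nonempty factors, so the first letter of a factor
  identifies its index, and the index list can be read off from the left.\<close>

lemma concat_map_inj:
  assumes "concat (map f I) = concat (map f J)" "set I = S" "set J = S"
    "distinct (concat (map f I))" "\<And>i. i \<in> S \<Longrightarrow> f i \<noteq> []"
  shows "I = J"
proof -
  have disj: "i = j" if "i \<in> S" "j \<in> S" "x \<in> set (f i)" "x \<in> set (f j)" for i j x
    using that distinct_concat_map(2)[of f I i j] assms by blast
  have "concat (map f I') = concat (map f J') \<Longrightarrow> set I' \<subseteq> S \<Longrightarrow> set J' \<subseteq> S \<Longrightarrow> I' = J'" for I' J'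
  proof (induction I' arbitrary: J')
    case Nil
    then show ?case using assms(5) by (cases J') auto
  next
    case (Cons i I')
    have "f i \<noteq> []" using Cons.prems assms(5) by auto
    then obtain j J'' where J: "J' = j # J''" using Cons.prems by (cases J') auto
    have "f j \<noteq> []" using Cons.prems assms(5) J by auto
    have "hd (f i) = hd (concat (map f (i # I')))" using \<open>f i \<noteq> []\<close> by simp
    also have "\<dots> = hd (f j)" using \<open>f j \<noteq> []\<close> Cons.prems J by simp
    finally have "hd (f i) = hd (f j)" .
    then have "hd (f i) \<in> set (f i)" "hd (f i) \<in> set (f j)"
      using \<open>f i \<noteq> []\<close> \<open>f j \<noteq> []\<close> hd_in_set by metis+
    then have "i = j" using disj[of i j] Cons.prems J by auto
    then show ?case using Cons J by auto
  qed
  then show ?thesis using assms by auto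
qed

text \<open>If every element is its own inverse, inverting a product shows that the factors
  commute.\<close>

lemma (in group) ex_square_neq_one:
  assumes "\<not> comm_group G"
  shows "\<exists>d\<in>carrier G. d \<otimes> d \<noteq> \<one>"
proof (rule ccontr)
  assume "\<not> ?thesis"
  then have sq: "x \<otimes> x = \<one>" if "x \<in> carrier G" for x using that by blast
  have inv: "inv x = x" if "x \<in> carrier G" for x using inv_equality[OF sq] that by simp
  have "x \<otimes> y = y \<otimes> x" if "x \<in> carrier G" "y \<in> carrier G" for x y
    using inv[of "x \<otimes> y"] inv_mult_group[of x y] inv that by simp
  then have "comm_group G" using group_comm_groupI by blast
  then show False using assms by simp
qed

text \<open>Words in \<open>C\<close> use each letter of \<open>X\<close> exactly once, so each
  competing index list \<open>I\<close> selects disjoint factors that together cover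
  \<open>X\<close> outside \<open>p\<close> and \<open>q\<close>. The cases are: some index occurs
  in no \<open>I\<close>, some index occurs in one \<open>I\<close> but not in another, or every
  \<open>I\<close> is a permutation of all indices.\<close>

lemma separating_assignment:
  fixes vs :: "'a list list" and G :: "('g, 'm) monoid_scheme" (structure)
  assumes "group G" and nab: "\<not> comm_group G"
    and C: "\<And>w. w \<in> C \<Longrightarrow> distinct w \<and> set w = X" and sc: "scattered n C"
    and vs: "length vs \<le> n" "[] \<notin> set vs" and notin: "p @ concat vs @ q \<notin> C"
  shows "\<exists>\<phi>. range \<phi> \<subseteq> carrier G \<and> (\<forall>I. set I \<subseteq> {..<length vs} \<longrightarrow>
    p @ concat (map ((!) vs) I) @ q \<in> C \<longrightarrow> mprod G (map \<phi> I) \<noteq> mprod G (map \<phi> [0..<length vs]))"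
proof -
  interpret group G by fact
  define l where "l = length vs"
  define Is where "Is = {I. set I \<subseteq> {..<l} \<and> p @ concat (map ((!) vs) I) @ q \<in> C}"
  have ne: "vs ! i \<noteq> []" if "i < l" for i using that vs(2) nth_mem unfolding l_def by metis
  have Is: "set I \<subseteq> {..<l}" "distinct (concat (map ((!) vs) I))" "distinct I"
    "(\<Union>i\<in>set I. set (vs ! i)) = X - set p - set q"
    "\<And>i j. i \<in> set I \<Longrightarrow> j \<in> set I \<Longrightarrow> i \<noteq> j \<Longrightarrow> set (vs ! i) \<inter> set (vs ! j) = {}"
    if I: "I \<in> Is" for I
  proof -
    show sub: "set I \<subseteq> {..<l}" using I by (simp add: Is_def)
    have "p @ concat (map ((!) vs) I) @ q \<in> C" using I by (simp add: Is_def)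
    from C[OF this] have "distinct (p @ concat (map ((!) vs) I) @ q)"
      and X: "set (p @ concat (map ((!) vs) I) @ q) = X" by blast+
    then show d: "distinct (concat (map ((!) vs) I))" by simp
    show "(\<Union>i\<in>set I. set (vs ! i)) = X - set p - set q"
      using \<open>distinct (p @ concat (map ((!) vs) I) @ q)\<close> unfolding X[symmetric] by auto
    have "\<And>i. i \<in> set I \<Longrightarrow> vs ! i \<noteq> []" using sub ne by auto
    from distinct_concat_map[OF d this] show "distinct I"
      "\<And>i j. i \<in> set I \<Longrightarrow> j \<in> set I \<Longrightarrow> i \<noteq> j \<Longrightarrow> set (vs ! i) \<inter> set (vs ! j) = {}" by blast+
  qed
  \<comment> \<open>Only the indices \<open>i\<close> and \<open>j\<close> contribute to the
    product; \<open>i = j\<close> is allowed.\<close>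
  have two: "mprod G (map \<phi> I) = mprod G (map \<phi> (filter (\<lambda>k. k = i \<or> k = j) I))"
    if "\<phi> = (\<lambda>k. if k = i then a else if k = j then b else \<one>)" "a \<in> carrier G" "b \<in> carrier G"
    for \<phi> i j a b I
    by (rule mprod_filter) (use that in auto)
  have full: "filter (\<lambda>k. k = i \<or> k = j) [0..<l] = [i, j]" if "i < j" "j < l" for i j
  proof -
    let ?L = "filter (\<lambda>k. k = i \<or> k = j) [0..<l]"
    have "sorted ?L" by (simp add: sorted_wrt_filter)
    moreover have "?L = [i, j] \<or> ?L = [j, i]" using that by (intro distinct_pair_list) auto
    ultimately show ?thesis using that by auto
  qed
  have "\<exists>\<phi>. range \<phi> \<subseteq> carrier G \<and> (\<forall>I\<in>Is. mprod G (map \<phi> I) \<noteq> mprod G (map \<phi> [0..<l]))"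
  proof (cases "Is = {}")
    case True
    then show ?thesis by (intro exI[of _ "\<lambda>_. \<one>"]) auto
  next
    case False
    then obtain I0 where I0: "I0 \<in> Is" by blast
    obtain d where d: "d \<in> carrier G" "d \<otimes> d \<noteq> \<one>" using ex_square_neq_one[OF nab] by blast
    have d1: "d \<noteq> \<one>" using d by auto
    have dd: "d \<otimes> d \<noteq> d" using d d1 by (metis l_cancel_one')
    consider (unused) y where "y < l" "\<And>I. I \<in> Is \<Longrightarrow> y \<notin> set I"
      | (partial) I1 y where "I1 \<in> Is" "y < l" "y \<notin> set I1" "\<exists>I2\<in>Is. y \<in> set I2"
      | (perm) "\<And>I. I \<in> Is \<Longrightarrow> set I = {..<l}"
      using Is(1) I0 by (metis lessThan_iff subsetI subset_antisym)
    then show ?thesis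
    proof cases
      case unused
      \<comment> \<open>The test is repeated so that \<open>two\<close> applies with both indices
        equal to \<open>y\<close>.\<close>
      define \<phi> where "\<phi> = (\<lambda>k. if k = y then d else if k = y then d else \<one>)"
      have 0: "mprod G (map \<phi> I) = \<one>" if "I \<in> Is" for I
      proof -
        have "filter (\<lambda>k. k = y \<or> k = y) I = []" using unused that by (auto simp: filter_empty_conv)
        then show ?thesis using two[OF \<phi>_def, of I] d by simp
      qed
      have "filter (\<lambda>k. k = y \<or> k = y) [0..<l] = [y]"
      proof -
        have "[0..<l] = [0..<y] @ y # [Suc y..<l]"
          using unused by (metis less_imp_le_nat upt_add_eq_append le_add_diff_inverse add_0 upt_conv_Cons zero_le)
        then show ?thesis by (simp add: filter_empty_conv)
      qed
      then have "mprod G (map \<phi> [0..<l]) = d" using two[OF \<phi>_def, of "[0..<l]"] d by (simp add: \<phi>_def)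
      then show ?thesis using 0 d d1 by (intro exI[of _ \<phi>]) (auto simp: \<phi>_def)
    next
      case partial
      then obtain I2 where I2: "I2 \<in> Is" "y \<in> set I2" by blast
      \<comment> \<open>\<open>I1\<close> must cover a letter \<open>x\<close> of the factor
        \<open>y\<close> by another factor \<open>z\<close>. No competing list contains both
        indices, so its product is \<open>\<one>\<close> or \<open>d\<close>, while the full product
        is \<open>d \<otimes> d\<close>.\<close>
      obtain x where x: "x \<in> set (vs ! y)" using ne[OF partial(2)] by (meson all_not_in_conv set_empty)
      then have "x \<in> (\<Union>i\<in>set I1. set (vs ! i))" using Is(4) I2 partial(1) by blast
      then obtain z where z: "z \<in> set I1" "x \<in> set (vs ! z)" by blast
      have zl: "z < l" "z \<noteq> y" using z Is(1) partial by auto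
      define \<phi> where "\<phi> = (\<lambda>k. if k = y then d else if k = z then d else \<one>)"
      have 0: "mprod G (map \<phi> I) \<in> {\<one>, d}" if "I \<in> Is" for I
      proof -
        let ?L = "filter (\<lambda>k. k = y \<or> k = z) I"
        have "\<not> (y \<in> set I \<and> z \<in> set I)" using Is(5)[OF that, of y z] x z zl by blast
        then have "set ?L \<subseteq> {y} \<or> set ?L \<subseteq> {z}" by auto
        moreover have "distinct ?L" using Is(3)[OF that] by simp
        ultimately have "?L \<in> {[], [y], [z]}"
          by (cases ?L; cases "tl ?L") (auto simp: subset_iff)
        then show ?thesis using two[OF \<phi>_def, of I] d zl by (auto simp: \<phi>_def)
      qed
      have "filter (\<lambda>k. k = y \<or> k = z) [0..<l] = [y, z] \<or> filter (\<lambda>k. k = y \<or> k = z) [0..<l] = [z, y]"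
        using partial zl by (intro distinct_pair_list) auto
      then have "mprod G (map \<phi> [0..<l]) = d \<otimes> d"
        using two[OF \<phi>_def, of "[0..<l]"] d zl by (auto simp: \<phi>_def)
      then have "mprod G (map \<phi> I) \<noteq> mprod G (map \<phi> [0..<l])" if "I \<in> Is" for I
        using 0[OF that] d(2) dd by auto
      moreover have "range \<phi> \<subseteq> carrier G" using d by (auto simp: \<phi>_def)
      ultimately show ?thesis by blast
    next
      case perm
      \<comment> \<open>All competing lists permute the same at most \<open>n\<close> factors, so
        \<open>scattered\<close> leaves only one.\<close>
      have eq: "I = I0" if "I \<in> Is" for I
      proof (rule concat_map_inj)
        have "set (map ((!) vs) I) = set (map ((!) vs) I0)" "length (map ((!) vs) I) \<le> n"
          using perm that I0 distinct_card[OF Is(3)[OF that]] vs(1) by (auto simp: l_def)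
        then show "concat (map ((!) vs) I) = concat (map ((!) vs) I0)"
          using sc that I0 unfolding scattered_def Is_def by blast
      qed (use perm that I0 Is(2) ne in auto)
      \<comment> \<open>The increasing list spells the word that is not in \<open>C\<close>, so
        \<open>I0\<close> has an inversion.\<close>
      have "I0 \<noteq> [0..<l]" using notin I0 by (auto simp: Is_def l_def map_nth)
      then have "\<not> sorted I0"
        using sorted_distinct_set_unique[of I0 "[0..<l]"] perm[OF I0] Is(3)[OF I0] by (auto simp: atLeast0LessThan)
      then obtain i j xs ys zs where ij: "i < j" "I0 = xs @ j # ys @ i # zs"
        using not_sorted_inversion by blast
      then have "j \<in> set I0" by simp
      then have "j < l" using perm[OF I0] by auto
      have "filter (\<lambda>k. k = i \<or> k = j) L = []" if "i \<notin> set L" "j \<notin> set L" for L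
        using that by (auto simp: filter_empty_conv)
      then have inverted: "filter (\<lambda>k. k = i \<or> k = j) I0 = [j, i]" using Is(3)[OF I0] ij by simp
      obtain a b where ab: "a \<in> carrier G" "b \<in> carrier G" "a \<otimes> b \<noteq> b \<otimes> a"
        using nab group_comm_groupI by blast
      define \<phi> where "\<phi> = (\<lambda>k. if k = i then a else if k = j then b else \<one>)"
      have "mprod G (map \<phi> I0) = b \<otimes> a"
        using two[OF \<phi>_def ab(1,2), of I0] ij(1) ab(1,2) unfolding inverted by (simp add: \<phi>_def)
      moreover have "mprod G (map \<phi> [0..<l]) = a \<otimes> b"
        using two[OF \<phi>_def, of "[0..<l]"] full[OF ij(1) \<open>j < l\<close>] ij ab by (simp add: \<phi>_def)
      ultimately show ?thesis using ab eq by (intro exI[of _ \<phi>]) (auto simp: \<phi>_def)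
    qed
  qed
  then show ?thesis unfolding Is_def l_def by (simp only: Ball_def mem_Collect_eq imp_conjL)
qed

section \<open>The syntactic semiring\<close>

text \<open>The monomials of a term expanded by distributivity; lists absorb associativity.\<close>

primrec words :: "tm \<Rightarrow> nat list set" where
  "words (Var i) = {[i]}"
| "words (Plus s t) = words s \<union> words t"
| "words (Times s t) = {a @ b |a b. a \<in> words s \<and> b \<in> words t}"

lemma finite_words: "finite (words t)"
proof (induction t)
  case (Times s t)
  then have "finite ((\<lambda>(a, b). a @ b) ` (words s \<times> words t))" by simp
  moreover have "words (Times s t) = (\<lambda>(a, b). a @ b) ` (words s \<times> words t)" by auto
  ultimately show ?case by simp
qed simp_all

text \<open>Needed to write the long identity with terms. The empty word is excluded because terms
  have no unit.\<close>

lemma ex_term_words: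
  assumes "finite F" "F \<noteq> {}" "[] \<notin> F"
  shows "\<exists>t. words t = F"
proof -
  have single: "\<exists>t. words t = {w}" if "w \<noteq> []" for w
    using that
  proof (induction w rule: list_nonempty_induct)
    case (single x)
    show ?case by (rule exI[of _ "Var x"]) simp
  next
    case (cons x w)
    then obtain t where "words t = {w}" by blast
    then show ?case by (intro exI[of _ "Times (Var x) t"]) auto
  qed
  show ?thesis using assms
  proof (induction rule: finite_ne_induct)
    case (singleton w)
    then show ?case using single by simp
  next
    case (insert w F)
    then obtain t where "words t = F" by auto
    moreover obtain s where "words s = {w}" using single[of w] insert.prems by blast
    ultimately show ?case by (intro exI[of _ "Plus s t"]) simp
  qed
qed

text \<open>Complex multiplication distributes over unions, so the value is the union over all
  monomials, with an independent choice at each occurrence of a variable. It is used both for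
  \<open>G\<close> and for \<open>word_monoid\<close>.\<close>

lemma tm_val_power_group:
  assumes "monoid M" and A: "range A \<subseteq> Pow (carrier M)"
  shows "g \<in> tm_val (power_group M) A t \<longleftrightarrow>
    (\<exists>w\<in>words t. \<exists>gs. list_all2 (\<lambda>g i. g \<in> A i) gs w \<and> mprod M gs = g)"
proof (induction t arbitrary: g)
  case (Var i)
  interpret monoid M by fact
  have "g \<in> carrier M" if "g \<in> A i" for g using A that by auto
  then show ?case by (auto simp: list_all2_Cons2)
next
  case (Plus s t)
  then show ?case by (auto simp: power_group_def)
next
  case (Times s t)
  interpret monoid M by fact
  have sub: "set gs \<subseteq> carrier M" if "list_all2 (\<lambda>g i. g \<in> A i) gs w" for gs w
    using that A by (induction rule: list_all2_induct) auto
  show ?case (is "?L \<longleftrightarrow> ?R")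
  proof
    assume ?L
    then obtain a b where ab: "a \<in> tm_val (power_group M) A s" "b \<in> tm_val (power_group M) A t"
      "g = a \<otimes>\<^bsub>M\<^esub> b" by (auto simp: power_group_def set_mult_def)
    then obtain w ws v vs where "w \<in> words s" "list_all2 (\<lambda>g i. g \<in> A i) ws w" "mprod M ws = a"
      "v \<in> words t" "list_all2 (\<lambda>g i. g \<in> A i) vs v" "mprod M vs = b"
      using Times.IH by blast
    then show ?R using ab sub
      by (intro bexI[of _ "w @ v"] exI[of _ "ws @ vs"]) (auto simp: mprod_append intro: list_all2_appendI)
  next
    assume ?R
    then obtain w v gs where wv: "w \<in> words s" "v \<in> words t" "list_all2 (\<lambda>g i. g \<in> A i) gs (w @ v)"
      "mprod M gs = g" by auto
    then obtain ws vs where gs: "gs = ws @ vs" "list_all2 (\<lambda>g i. g \<in> A i) ws w"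
      "list_all2 (\<lambda>g i. g \<in> A i) vs v" by (auto simp: list_all2_append2)
    then have "g = mprod M ws \<otimes>\<^bsub>M\<^esub> mprod M vs" using wv sub mprod_append by metis
    moreover have "mprod M ws \<in> tm_val (power_group M) A s" "mprod M vs \<in> tm_val (power_group M) A t"
      using Times.IH wv gs by blast+
    ultimately show ?L by (auto simp: power_group_def set_mult_def)
  qed
qed

definition word_monoid :: "'a list monoid" where
  "word_monoid = \<lparr> carrier = UNIV, mult = (@), one = [] \<rparr>"

lemma mult_word_monoid: "x \<otimes>\<^bsub>word_monoid\<^esub> y = x @ y"
  by (simp add: word_monoid_def)

lemma monoid_word_monoid: "monoid word_monoid"
  by unfold_locales (auto simp: word_monoid_def)

lemma mprod_word_monoid: "mprod word_monoid = concat"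
  by (rule ext) (simp add: mprod_def word_monoid_def concat_conv_foldr)

text \<open>The syntactic semiring of the language \<open>C\<close>: a set of words is replaced by the largest set
  with the same contexts into \<open>C\<close>. The empty word is left out, since a semiring variable
  cannot be erased.\<close>

definition closure :: "'a list set \<Rightarrow> 'a list set \<Rightarrow> 'a list set" where
  "closure C A = {w. w \<noteq> [] \<and> (\<forall>p q. (\<forall>a\<in>A. p @ a @ q \<in> C) \<longrightarrow> p @ w @ q \<in> C)}"

definition syntactic_alg :: "'a list set \<Rightarrow> 'a list set alg22" where
  "syntactic_alg C = \<lparr> carrier = closure C ` Pow (- {[]}),
     aplus = (\<lambda>A B. closure C (A \<union> B)), atimes = (\<lambda>A B. closure C (A <#>\<^bsub>word_monoid\<^esub> B)) \<rparr>"

lemma Nil_notin_closure: "[] \<notin> closure C A"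
  by (simp add: closure_def)

lemma closure_extensive: "[] \<notin> A \<Longrightarrow> A \<subseteq> closure C A"
  by (auto simp: closure_def)

lemma closure_least: "A \<subseteq> closure C B \<Longrightarrow> closure C A \<subseteq> closure C B"
  unfolding closure_def by blast

lemma closure_Un:
  assumes "[] \<notin> A" "[] \<notin> B"
  shows "closure C (closure C A \<union> closure C B) = closure C (A \<union> B)"
proof (rule antisym)
  have "A \<union> B \<subseteq> closure C (A \<union> B)" using assms by (intro closure_extensive) simp
  then have "closure C A \<subseteq> closure C (A \<union> B)" "closure C B \<subseteq> closure C (A \<union> B)"
    by (auto intro!: closure_least)
  then show "closure C (closure C A \<union> closure C B) \<subseteq> closure C (A \<union> B)" by (simp add: closure_least)
  have "A \<union> B \<subseteq> closure C A \<union> closure C B" using closure_extensive assms by blast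
  also have "\<dots> \<subseteq> closure C (closure C A \<union> closure C B)"
    by (intro closure_extensive) (simp add: Nil_notin_closure)
  finally show "closure C (A \<union> B) \<subseteq> closure C (closure C A \<union> closure C B)" by (rule closure_least)
qed

lemma closure_mult:
  assumes "[] \<notin> A" "[] \<notin> B"
  shows "closure C (closure C A <#>\<^bsub>word_monoid\<^esub> closure C B) = closure C (A <#>\<^bsub>word_monoid\<^esub> B)"
proof (rule antisym)
  have "p @ (a @ b) @ q \<in> C"
    if a: "a \<in> closure C A" and b: "b \<in> closure C B"
      and pq: "\<forall>c\<in>A <#>\<^bsub>word_monoid\<^esub> B. p @ c @ q \<in> C" for a b p q
  proof -
    \<comment> \<open>Contexts are shifted: \<open>a\<close> is replaced within the right context
      \<open>y @ q\<close>, then \<open>b\<close> within the left context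
      \<open>p @ a\<close>.\<close>
    have "p @ x @ (y @ q) \<in> C" if "x \<in> A" "y \<in> B" for x y
      using pq that by (force simp: set_mult_def word_monoid_def)
    then have "p @ a @ (y @ q) \<in> C" if "y \<in> B" for y
      using a that unfolding closure_def by blast
    then have "(p @ a) @ y @ q \<in> C" if "y \<in> B" for y using that by simp
    then have "(p @ a) @ b @ q \<in> C" using b unfolding closure_def by blast
    then show ?thesis by simp
  qed
  then have "closure C A <#>\<^bsub>word_monoid\<^esub> closure C B \<subseteq> closure C (A <#>\<^bsub>word_monoid\<^esub> B)"
    using Nil_notin_closure[of C A]
    by (auto simp: closure_def[of C "A <#>\<^bsub>word_monoid\<^esub> B"] set_mult_def[of _ "closure C A"] mult_word_monoid)
  then show "closure C (closure C A <#>\<^bsub>word_monoid\<^esub> closure C B) \<subseteq> closure C (A <#>\<^bsub>word_monoid\<^esub> B)"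
    by (rule closure_least)
  have "A <#>\<^bsub>word_monoid\<^esub> B \<subseteq> closure C A <#>\<^bsub>word_monoid\<^esub> closure C B"
    using closure_extensive assms by (intro mono_set_mult) auto
  also have "\<dots> \<subseteq> closure C (closure C A <#>\<^bsub>word_monoid\<^esub> closure C B)"
    using Nil_notin_closure[of C A] by (intro closure_extensive) (auto simp: set_mult_def word_monoid_def)
  finally show "closure C (A <#>\<^bsub>word_monoid\<^esub> B)
      \<subseteq> closure C (closure C A <#>\<^bsub>word_monoid\<^esub> closure C B)"
    by (rule closure_least)
qed

lemma Nil_notin_tm_val:
  assumes "\<And>i. [] \<notin> \<theta> i"
  shows "[] \<notin> tm_val (power_group word_monoid) \<theta> t"
  using assms by (induction t) (auto simp: power_group_def set_mult_def word_monoid_def)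

text \<open>\<open>closure C\<close> is a homomorphism from languages without the empty word. Every
  assignment into the syntactic semiring arises from such languages, so identities can be tested on
  them.\<close>

lemma tm_val_syntactic_alg:
  assumes "\<And>i. [] \<notin> \<theta> i"
  shows "tm_val (syntactic_alg C) (\<lambda>i. closure C (\<theta> i)) t =
    closure C (tm_val (power_group word_monoid) \<theta> t)"
proof (induction t)
  case (Plus s t)
  have "aplus (syntactic_alg C) X Y = closure C (X \<union> Y)" for X Y
    by (simp add: syntactic_alg_def)
  then show ?case
    using closure_Un[of "tm_val (power_group word_monoid) \<theta> s" "tm_val (power_group word_monoid) \<theta> t" C]
      Nil_notin_tm_val[of \<theta>] assms
    by (simp add: Plus power_group_def)
next
  case (Times s t)
  have "atimes (syntactic_alg C) X Y = closure C (X <#>\<^bsub>word_monoid\<^esub> Y)" for X Y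
    by (simp add: syntactic_alg_def)
  then show ?case
    using closure_mult[of "tm_val (power_group word_monoid) \<theta> s" "tm_val (power_group word_monoid) \<theta> t" C]
      Nil_notin_tm_val[of \<theta>] assms
    by (simp add: Times power_group_def)
qed simp

lemma algebra22_syntactic_alg: "algebra22 (syntactic_alg C)"
proof -
  have "closure C A \<union> closure C B \<subseteq> - {[]}"
    "closure C A <#>\<^bsub>word_monoid\<^esub> closure C B \<subseteq> - {[]}" for A B
    using Nil_notin_closure[of C A] Nil_notin_closure[of C B]
    by (auto simp: set_mult_def word_monoid_def)
  then show ?thesis by (auto simp: algebra22_def syntactic_alg_def)
qed

section \<open>Transfer of short identities to the syntactic semiring\<close>

text \<open>Group elements are attached to the positions of \<open>w\<close>, and a variable
  receives the set of elements at its occurrences. The product over \<open>w\<close> then also lies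
  in the value of \<open>t\<close>, and each element chosen there comes from a position carrying the
  right variable.\<close>

lemma power_group_identity_choice:
  assumes "monoid G" and st: "(s, t) \<in> identities (power_group G)" and w: "w \<in> words s"
    and \<phi>: "range \<phi> \<subseteq> carrier G"
  shows "\<exists>I. set I \<subseteq> {..<length w} \<and> map ((!) w) I \<in> words t \<and>
    mprod G (map \<phi> I) = mprod G (map \<phi> [0..<length w])"
proof -
  define A where "A = (\<lambda>z. {\<phi> i |i. i < length w \<and> w ! i = z})"
  have A: "range A \<subseteq> Pow (carrier G)" using \<phi> by (auto simp: A_def)
  then have eq: "tm_val (power_group G) A s = tm_val (power_group G) A t"
    using st by (simp add: identities_def sat_ident_def power_group_def)
  have "list_all2 (\<lambda>g i. g \<in> A i) (map \<phi> [0..<length w]) w"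
    by (auto simp: list_all2_conv_all_nth A_def)
  then have "mprod G (map \<phi> [0..<length w]) \<in> tm_val (power_group G) A t"
    using tm_val_power_group[OF assms(1) A] w eq by blast
  then obtain w' gs where w': "w' \<in> words t" "list_all2 (\<lambda>g i. g \<in> A i) gs w'"
    "mprod G gs = mprod G (map \<phi> [0..<length w])"
    using tm_val_power_group[OF assms(1) A] by blast
  have "\<exists>I. set I \<subseteq> {..<length w} \<and> gs = map \<phi> I \<and> w' = map ((!) w) I"
    using w'(2)
  proof (induction rule: list_all2_induct)
    case (Cons g gs z zs)
    then obtain i I where "i < length w" "g = \<phi> i" "w ! i = z"
      "set I \<subseteq> {..<length w}" "gs = map \<phi> I" "zs = map ((!) w) I" by (auto simp: A_def)
    then show ?case by (intro exI[of _ "i # I"]) auto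
  qed simp
  then show ?thesis using w' by metis
qed

text \<open>If a context moved all of the value of \<open>t\<close> into \<open>C\<close>, but not
  \<open>x\<close>, a separating assignment would exist. The choice lemma yields a selection of
  factors of \<open>x\<close> in the value of \<open>t\<close> with the same product, a
  contradiction.\<close>

lemma tm_val_subset_closure:
  assumes G: "group G" "\<not> comm_group G" and st: "(s, t) \<in> identities (power_group G)"
    and C: "\<And>w. w \<in> C \<Longrightarrow> distinct w \<and> set w = X" "scattered n C"
    and n: "\<And>w. w \<in> words s \<Longrightarrow> length w \<le> n" and \<theta>: "\<And>i. [] \<notin> \<theta> i"
  shows "tm_val (power_group word_monoid) \<theta> s \<subseteq> closure C (tm_val (power_group word_monoid) \<theta> t)"
proof
  fix x assume x: "x \<in> tm_val (power_group word_monoid) \<theta> s"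
  have \<theta>': "range \<theta> \<subseteq> Pow (carrier word_monoid)" by (simp add: word_monoid_def)
  note val = tm_val_power_group[OF monoid_word_monoid \<theta>', unfolded mprod_word_monoid]
  obtain w vs where w: "w \<in> words s" "list_all2 (\<lambda>v i. v \<in> \<theta> i) vs w" "concat vs = x"
    using x val by blast
  then have len: "length vs = length w" by (simp add: list_all2_lengthD)
  have ne: "[] \<notin> set vs" using w(2) \<theta> by (induction rule: list_all2_induct) auto
  have "p @ x @ q \<in> C" if pq: "\<forall>a\<in>tm_val (power_group word_monoid) \<theta> t. p @ a @ q \<in> C" for p q
  proof (rule ccontr)
    assume "p @ x @ q \<notin> C"
    then have "p @ concat vs @ q \<notin> C" using w by simp
    from separating_assignment[OF G C _ ne this] n[OF w(1)] len
    obtain \<phi> where \<phi>: "range \<phi> \<subseteq> carrier G" "\<And>I. set I \<subseteq> {..<length w} \<Longrightarrow>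
        p @ concat (map ((!) vs) I) @ q \<in> C \<Longrightarrow> mprod G (map \<phi> I) \<noteq> mprod G (map \<phi> [0..<length w])"
      by auto
    obtain I where I: "set I \<subseteq> {..<length w}" "map ((!) w) I \<in> words t"
      "mprod G (map \<phi> I) = mprod G (map \<phi> [0..<length w])"
      using power_group_identity_choice[OF group.axioms(1)[OF G(1)] st w(1) \<phi>(1)]
      by (auto simp: group_def)
    have "list_all2 (\<lambda>v i. v \<in> \<theta> i) (map ((!) vs) I) (map ((!) w) I)"
      using I(1) w(2) len by (auto simp: list_all2_conv_all_nth subset_iff)
    then have "concat (map ((!) vs) I) \<in> tm_val (power_group word_monoid) \<theta> t"
      using val I(2) by blast
    then show False using \<phi>(2)[OF I(1)] pq I(3) by blast
  qed
  moreover have "x \<noteq> []" using Nil_notin_tm_val[of \<theta> s] \<theta> x by auto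
  ultimately show "x \<in> closure C (tm_val (power_group word_monoid) \<theta> t)" unfolding closure_def by blast
qed

lemma syntactic_alg_satisfies_short:
  assumes G: "group G" "\<not> comm_group G" and st: "(s, t) \<in> identities (power_group G)"
    and C: "\<And>w. w \<in> C \<Longrightarrow> distinct w \<and> set w = X" "scattered n C"
    and n: "\<And>w. w \<in> words s \<union> words t \<Longrightarrow> length w \<le> n"
  shows "(s, t) \<in> identities (syntactic_alg C)"
proof -
  have "tm_val (syntactic_alg C) v s = tm_val (syntactic_alg C) v t"
    if v: "range v \<subseteq> carrier (syntactic_alg C)" for v
  proof -
    have "\<forall>i. \<exists>A. [] \<notin> A \<and> v i = closure C A" 
    proof
      fix i
      have "v i \<in> carrier (syntactic_alg C)" using v by auto
      then show "\<exists>A. [] \<notin> A \<and> v i = closure C A" by (auto simp: syntactic_alg_def)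
    qed
    then obtain \<theta> where \<theta>: "\<And>i. [] \<notin> \<theta> i" "v = (\<lambda>i. closure C (\<theta> i))" by metis
    have ts: "(t, s) \<in> identities (power_group G)" using st by (simp add: identities_def sat_ident_def)
    have "closure C (tm_val (power_group word_monoid) \<theta> s) =
        closure C (tm_val (power_group word_monoid) \<theta> t)"
      using tm_val_subset_closure[OF G st C _ \<theta>(1)] tm_val_subset_closure[OF G ts C _ \<theta>(1)] n
      by (intro antisym closure_least) auto
    then show ?thesis using tm_val_syntactic_alg[of \<theta> C] \<theta> by simp
  qed
  then show ?thesis by (simp add: identities_def sat_ident_def)
qed

section \<open>A long identity\<close>

text \<open>Equal prefix products at consecutive cuts force the block between them to evaluate to
  \<open>\<one>\<close>.\<close>

lemma mprod_rev_blocks: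
  fixes G (structure)
  assumes "group G" and f: "range f \<subseteq> carrier G" and ts: "sorted_wrt (<) ts"
    and mono: "\<And>t. t \<in> set ts \<Longrightarrow> mprod G (map f [0..<t]) = h"
  shows "mprod G (map f (rev_blocks ts)) = \<one>\<^bsub>G\<^esub>"
proof -
  interpret group G by fact
  have cl: "set (map f xs) \<subseteq> carrier G" for xs using f by auto
  show ?thesis using ts mono
  proof (induction ts rule: rev_blocks.induct)
    case (1 s t ts)
    have "[0..<t] = [0..<s] @ [s..<t]" using 1 upt_add_eq_append[of 0 s "t - s"] by simp
    then have "h = h \<otimes>\<^bsub>G\<^esub> mprod G (map f [s..<t])"
      using 1 mprod_append[OF cl[of "[0..<s]"] cl[of "[s..<t]"]] by (metis list.set_intros map_append)
    moreover have "h \<in> carrier G" using 1 mprod_closed[OF cl[of "[0..<s]"]] by force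
    ultimately have "mprod G (map f [s..<t]) = \<one>\<^bsub>G\<^esub>"
      by (metis cl l_cancel_one mprod_closed)
    then show ?case using 1 mprod_append[OF cl[of "rev_blocks (t # ts)"] cl[of "[s..<t]"]] by simp
  qed auto
qed

lemma mprod_cut_word:
  fixes G (structure)
  assumes "group G" and f: "range f \<subseteq> carrier G" and e: "finite e" "e \<noteq> {}" "e \<subseteq> {..N}"
    and mono: "\<And>t. t \<in> e \<Longrightarrow> mprod G (map f [0..<t]) = h"
  shows "mprod G (map f (cut_word N e)) = mprod G (map f [0..<N])"
proof -
  interpret group G by fact
  have append: "mprod G (map f (xs @ ys)) = mprod G (map f xs) \<otimes> mprod G (map f ys)" for xs ys
    unfolding map_append using f by (intro mprod_append) auto
  have closed: "mprod G (map f xs) \<in> carrier G" for xs using f by (intro mprod_closed) auto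
  obtain s ts where *: "sorted_wrt (<) (s # ts)" "set (s # ts) = e" "s = Min e"
    "last (s # ts) = Max e" "cut_word N e = [0..<s] @ rev_blocks (s # ts) @ [Max e..<N]"
    using cut_word_cases[OF e(1,2)] by metis
  have M: "Max e \<in> e" "Max e \<le> N" "s \<in> e" using e * by auto
  have "mprod G (map f (rev_blocks (s # ts))) = \<one>"
    using mprod_rev_blocks[OF assms(1) f *(1)] mono *(2) by blast
  then have "mprod G (map f (cut_word N e)) = mprod G (map f [0..<s]) \<otimes> mprod G (map f [Max e..<N])"
    using closed by (simp add: *(5) append del: rev_blocks.simps map_append)
  also have "\<dots> = mprod G (map f [0..<Max e]) \<otimes> mprod G (map f [Max e..<N])"
    using mono M by simp
  also have "\<dots> = mprod G (map f ([0..<Max e] @ [Max e..<N]))"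
    by (rule append[symmetric])
  also have "[0..<Max e] @ [Max e..<N] = [0..<N]"
    using M(2) upt_add_eq_append[of 0 "Max e" "N - Max e"] by simp
  finally show ?thesis .
qed

lemma tm_val_singletons: "tm_val (power_group word_monoid) (\<lambda>i. {[i]}) t = words t"
  by (induction t) (auto simp: power_group_def set_mult_def mult_word_monoid)

text \<open>Each variable occurs once in the word of \<open>s\<close>, so a choice per occurrence is
  a choice \<open>f\<close> per variable, which can be reused in a word of \<open>t\<close>.\<close>

lemma tm_val_power_group_mono:
  assumes "group G" and range: "range A \<subseteq> Pow (carrier G)"
    and s: "words s = {[0..<N]}"
    and t: "\<And>f. range f \<subseteq> carrier G \<Longrightarrow>
      \<exists>w\<in>words t. set w \<subseteq> {..<N} \<and> mprod G (map f w) = mprod G (map f [0..<N])"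
  shows "tm_val (power_group G) A s \<subseteq> tm_val (power_group G) A t"
proof
  interpret group G by fact
  note val = tm_val_power_group[OF is_monoid range]
  fix g assume "g \<in> tm_val (power_group G) A s"
  then obtain gs where gs: "list_all2 (\<lambda>g i. g \<in> A i) gs [0..<N]" "mprod G gs = g"
    using val s by auto
  then have len: "length gs = N" and A: "\<And>i. i < N \<Longrightarrow> gs ! i \<in> A i"
    by (auto simp: list_all2_conv_all_nth)
  define f where "f = (\<lambda>i. if i < N then gs ! i else \<one>\<^bsub>G\<^esub>)"
  have "range f \<subseteq> carrier G" using A range by (fastforce simp: f_def)
  from t[OF this] obtain w where w: "w \<in> words t" "set w \<subseteq> {..<N}"
    "mprod G (map f w) = mprod G (map f [0..<N])" by blast
  have "map f [0..<N] = gs" using len by (auto simp: f_def intro!: nth_equalityI)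
  moreover have "list_all2 (\<lambda>g i. g \<in> A i) (map f w) w"
    using w(2) A by (auto simp: list_all2_conv_all_nth f_def subset_iff)
  ultimately show "g \<in> tm_val (power_group G) A t" using val w gs by metis
qed

text \<open>Two cuts bound a single block; a third cut produces an inversion.\<close>

lemma cut_word_neq_upt:
  assumes "finite e" "3 \<le> card e"
  shows "cut_word N e \<noteq> [0..<N]"
proof
  assume eq: "cut_word N e = [0..<N]"
  have "\<not> e \<subseteq> {Min e, Max e}"
    using assms(2) card_mono[of "{Min e, Max e}" e] card_length[of "[Min e, Max e]"] by auto
  then obtain t where "t \<in> e" "t \<noteq> Min e" "t \<noteq> Max e" by blast
  then obtain xs ys where "[0..<N] = xs @ t # ys" "t - 1 \<in> set ys"
    using cut_word_inverted[OF assms(1), of t N] eq by auto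
  moreover have "sorted_wrt (<) [0..<N]" by simp
  ultimately have "t < t - 1" by (metis sorted_wrt_append sorted_wrt.simps(2))
  then show False by simp
qed

theorem theorem1p1:
  fixes G :: "('g, 'm) monoid_scheme"
  assumes "group G" and "finite (carrier G)" and "\<not> comm_group G" and "solvable G"
    and "infinite (UNIV :: 'b set)"
  shows "\<not> finite_ident_basis TYPE('b) (power_group G)"
proof
  interpret group G by fact
  assume "finite_ident_basis TYPE('b) (power_group G)"
  then obtain \<Sigma> where fin: "finite \<Sigma>" and basis: "ident_basis TYPE('b) (power_group G) \<Sigma>"
    by (auto simp: finite_ident_basis_def)
  have "finite (length ` (\<Union>e\<in>\<Sigma>. words (fst e) \<union> words (snd e)))"
    using fin finite_words by auto
  then obtain n where "\<forall>k\<in>length ` (\<Union>e\<in>\<Sigma>. words (fst e) \<union> words (snd e)). k \<le> n"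
    using finite_nat_set_iff_bounded_le by meson
  then have n: "length w \<le> n" if "(s, t) \<in> \<Sigma>" "w \<in> words s \<union> words t" for s t w
    using that by fastforce
  \<comment> \<open>The numbered group elements serve as colours.\<close>
  obtain h where h: "bij_betw h (carrier G) {0..<card (carrier G)}"
    using ex_bij_betw_finite_nat assms(2) by blast
  obtain N E where E: "E \<subseteq> Pow {0<..<N}" and large: "\<And>e. e \<in> E \<Longrightarrow> n + 5 \<le> card e"
    and far: "\<And>e e'. e \<in> E \<Longrightarrow> e' \<in> E \<Longrightarrow> e \<noteq> e' \<Longrightarrow> n + 5 \<le> card (e' - e)"
    and mono: "\<And>f :: nat \<Rightarrow> nat. f ` {0<..<N} \<subseteq> {..<card (carrier G)} \<Longrightarrow> \<exists>e\<in>E. \<exists>i. \<forall>t\<in>e. f t = i"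
    using ex_separated_family[of "n + 5" "card (carrier G)"] by metis
  have e: "finite e" "e \<noteq> {}" "e \<subseteq> {..N}" "e \<subseteq> {0<..<N}" if "e \<in> E" for e
  proof -
    show sub: "e \<subseteq> {0<..<N}" using E that by auto
    then show "finite e" "e \<subseteq> {..N}" by (auto intro: finite_subset)
    show "e \<noteq> {}" using large[OF that] by auto
  qed
  define C where "C = cut_word N ` E"
  have C: "distinct w \<and> set w = {..<N}" if "w \<in> C" for w
    using that set_distinct_cut_word e by (auto simp: C_def)
  have sc: "scattered n C"
    unfolding C_def using E e(2) far by (intro scattered_cut_words) auto
  have mono_cut: "\<exists>w\<in>C. mprod G (map f w) = mprod G (map f [0..<N])" if f: "range f \<subseteq> carrier G" for f
  proof -
    have pi: "mprod G (map f [0..<t]) \<in> carrier G" for t using f by (intro mprod_closed) auto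
    \<comment> \<open>Each cut \<open>t\<close> is coloured by the product of the first
      \<open>t\<close> values.\<close>
    have "(\<lambda>t. h (mprod G (map f [0..<t]))) ` {0<..<N} \<subseteq> {..<card (carrier G)}"
      using bij_betw_apply[OF h pi] by auto
    from mono[OF this] obtain d i where d: "d \<in> E" "\<And>t. t \<in> d \<Longrightarrow> h (mprod G (map f [0..<t])) = i"
      by blast
    obtain t0 where t0: "t0 \<in> d" using e(2)[OF d(1)] by blast
    have "mprod G (map f [0..<t]) = mprod G (map f [0..<t0])" if "t \<in> d" for t
      using bij_betw_imp_inj_on[OF h] pi d(2)[OF that] d(2)[OF t0] by (auto dest: inj_onD)
    from mprod_cut_word[OF assms(1) f e(1-3)[OF d(1)] this] show ?thesis using d(1) by (auto simp: C_def)
  qed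
  \<comment> \<open>Any assignment will do here; the trivial one is at hand.\<close>
  have "C \<noteq> {}" using mono_cut[of "\<lambda>_. \<one>\<^bsub>G\<^esub>"] by auto
  then obtain d where d: "d \<in> E" by (auto simp: C_def)
  have N: "0 < N" using e(2,4)[OF d] by auto
  have "finite E" using E by (rule finite_subset) simp
  moreover have "[] \<notin> C" using C N by fastforce
  ultimately obtain t where t: "words t = C"
    using ex_term_words[of C] \<open>C \<noteq> {}\<close> by (auto simp: C_def)
  have "\<exists>s. words s = {[0..<N]}" using N by (intro ex_term_words) (auto simp: upt_conv_Cons)
  then obtain s where s: "words s = {[0..<N]}" by blast
  have "tm_val (power_group G) A s \<subseteq> tm_val (power_group G) A t"
    if "range A \<subseteq> Pow (carrier G)" for A
    using tm_val_power_group_mono[OF assms(1) that s, of t] mono_cut C by (auto simp: t)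
  \<comment> \<open>The inequality of \<open>s\<close> and \<open>t\<close> is written as the
    identity \<open>s + t = t\<close>.\<close>
  then have "(Plus s t, t) \<in> identities (power_group G)"
    by (auto simp: identities_def sat_ident_def power_group_def)
  moreover have "\<Sigma> \<subseteq> identities (syntactic_alg C)"
  proof
    fix x assume x: "x \<in> \<Sigma>"
    then have "x \<in> identities (power_group G)" using basis by (auto simp: ident_basis_def)
    then show "x \<in> identities (syntactic_alg C)"
      using syntactic_alg_satisfies_short[OF assms(1,3) _ C sc, of "fst x" "snd x"] n[of "fst x" "snd x"] x
      by simp
  qed
  ultimately have "sat_ident (syntactic_alg C) (Plus s t, t)"
    using ident_basis_all_algebras[OF assms(5) basis algebra22_syntactic_alg]
    by (auto simp: identities_def)
  \<comment> \<open>With each variable sent to its own letter, a term takes the closure of its words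
    as value.\<close>
  moreover have "range (\<lambda>i. closure C {[i]}) \<subseteq> carrier (syntactic_alg C)"
    by (auto simp: syntactic_alg_def)
  ultimately have "tm_val (syntactic_alg C) (\<lambda>i. closure C {[i]}) (Plus s t) =
      tm_val (syntactic_alg C) (\<lambda>i. closure C {[i]}) t"
    unfolding sat_ident_def fst_conv snd_conv by blast
  moreover have "tm_val (syntactic_alg C) (\<lambda>i. closure C {[i]}) r = closure C (words r)" for r
    using tm_val_syntactic_alg[of "\<lambda>i. {[i]}" C] by (simp add: tm_val_singletons)
  ultimately have "closure C (words (Plus s t)) = closure C (words t)" by (simp only:)
  moreover have "[0..<N] \<in> closure C (words (Plus s t))" using N by (simp add: s closure_def)
  ultimately have "[0..<N] \<in> closure C C" by (simp add: t)
  \<comment> \<open>The empty context tests membership in \<open>C\<close> itself.\<close>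
  then have "(\<forall>a\<in>C. [] @ a @ [] \<in> C) \<longrightarrow> [] @ [0..<N] @ [] \<in> C" unfolding closure_def by blast
  then obtain e' where "e' \<in> E" "cut_word N e' = [0..<N]" by (auto simp: C_def)
  then show False using cut_word_neq_upt[OF e(1), of e' N] large[of e'] by auto
qed

end
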